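(* Let $\mathcal{H}$ be a real Hilbert space, let $T:\mathcal{H}\to\mathcal{H}$ be a nonexpansive mapping such that $\operatorname{Fix}T\neq\emptyset$, let $\lambda:[0,+\infty)\to[0,1]$ be a Lebesgue measurable function such that $$\int_0^{+\infty}\lambda(t)\,dt=+\infty,$$ and let $x_0\in\mathcal{H}$. Let $x:[0,+\infty)\to\mathcal{H}$ be the unique strong global solution of $$\dot x(t)=\lambda(t)\big(T(x(t))-x(t)\big),\qquad x(0)=x_0.$$ Then the following statements are true: (i) the trajectory $x$ is bounded and $\int_0^{+\infty}\|\dot x(t)\|^2\,dt<+\infty$; (ii) $\lim_{t\to+\infty}\big(T(x(t))-x(t)\big)=0$ (strongly); (iii) $\lim_{t\to+\infty}\dot x(t)=0$ (strongly); (iv) $x(t)$ converges weakly to a point in $\operatorname{Fix}T$, as $t\to+\infty$.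
   Context: $T$ is nonexpansive if $\|Tx-Ty\|\le\|x-y\|$ for all $x,y\in\mathcal{H}$; $\operatorname{Fix}T=\{x\in\mathcal{H}:Tx=x\}$. A strong global solution of the system is a function $x:[0,+\infty)\to\mathcal{H}$ which is absolutely continuous on each interval $[0,b]$, $0<b<+\infty$ (i.e. on $[0,b]$ it is the sum of a constant and the indefinite integral of an integrable $\mathcal{H}$-valued function), satisfies $\dot x(t)=\lambda(t)\big(T(x(t))-x(t)\big)$ for almost all $t\ge0$, and satisfies $x(0)=x_0$. Such a solution exists and is unique. The derivative $\dot x(t)$ exists for almost all $t\ge 0$; statements about $\dot x(t)$ are understood for those $t$ at which the derivative exists. *)

theory Defs
  imports "HOL-Analysis.Analysis"
begin

definition nonexpansive :: "('a::real_normed_vector \<Rightarrow> 'a) \<Rightarrow> bool" where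
  "nonexpansive T \<longleftrightarrow> (\<forall>u v. norm (T u - T v) \<le> norm (u - v))"

definition Fix :: "('a \<Rightarrow> 'a) \<Rightarrow> 'a set" where
  "Fix T = {u. T u = u}"

(* The library's has_bochner_integral requires a second countable (i.e. separable) codomain.
   This is the same definition with that restriction removed, so that it also covers
   nonseparable spaces; approximability by simple functions is what makes f strongly
   measurable there. *)
definition bochner_has_integral ::
    "'a measure \<Rightarrow> ('a \<Rightarrow> 'b::real_normed_vector) \<Rightarrow> 'b \<Rightarrow> bool" where
  "bochner_has_integral M f I \<longleftrightarrow>
     f \<in> borel_measurable M \<and>
     (\<exists>s. (\<forall>i. Bochner_Integration.simple_bochner_integrable M (s i)) \<and>
          (\<lambda>i. \<integral>\<^sup>+t. ennreal (norm (f t - s i t)) \<partial>M) \<longlonglongrightarrow> 0 \<and>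
          (\<lambda>i. Bochner_Integration.simple_bochner_integral M (s i)) \<longlonglongrightarrow> I)"

definition bochner_integrable :: "'a measure \<Rightarrow> ('a \<Rightarrow> 'b::real_normed_vector) \<Rightarrow> bool" where
  "bochner_integrable M f \<longleftrightarrow> (\<exists>I. bochner_has_integral M f I)"

(* Absolute continuity on [0,b] in the sense of being a constant plus an indefinite integral. *)
definition abs_continuous_upto :: "real \<Rightarrow> (real \<Rightarrow> 'a::real_normed_vector) \<Rightarrow> bool" where
  "abs_continuous_upto b x \<longleftrightarrow>
     (\<exists>c f. bochner_integrable (lebesgue_on {0..b}) f \<and>
            (\<forall>t\<in>{0..b}. \<exists>I. bochner_has_integral (lebesgue_on {0..t}) f I \<and> x t = c + I))"

(* Functions on [0,+oo) are total functions on the reals of which only the restriction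
   to {0..} matters; hence the derivatives within {0..}. *)
definition strong_global_solution ::
    "('a::real_normed_vector \<Rightarrow> 'a) \<Rightarrow> (real \<Rightarrow> real) \<Rightarrow> 'a \<Rightarrow> (real \<Rightarrow> 'a) \<Rightarrow> bool" where
  "strong_global_solution T l x0 x \<longleftrightarrow>
     (\<forall>b>0. abs_continuous_upto b x) \<and>
     (AE t in lebesgue_on {0..}.
        (x has_vector_derivative l t *\<^sub>R (T (x t) - x t)) (at t within {0..})) \<and>
     x 0 = x0"

definition weakly_tendsto :: "('a \<Rightarrow> 'b::real_inner) \<Rightarrow> 'b \<Rightarrow> 'a filter \<Rightarrow> bool" where
  "weakly_tendsto f p F \<longleftrightarrow> (\<forall>y. ((\<lambda>t. f t \<bullet> y) \<longlongrightarrow> p \<bullet> y) F)"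

end

(* The trajectory is only absolutely continuous and T is not differentiable, so all monotonicity is
   obtained from a one-sided fundamental theorem of calculus: an upper bound on difference quotients
   straddling almost every t, plus domination of increments by an indefinite integral.  It gives the
   energy estimate d/dt |x - q|^2 <= - lam |Tx - x|^2 for fixed points q and shows that the residual
   |Tx - x| decreases.  Hence |Tx(t) - x(t)|^2 times the integral of lam over [0,t] is at most
   |x0 - q|^2, and the residual tends to 0; it also bounds the speed.

   Weak compactness is not needed for the weak limit.  Nested bounded closed convex sets meet, so the
   closed convex hulls of the tails have a common point p.  For any p the function
   a -> |Tp - a|^2 - |p - a|^2 is affine, so its asymptotic bound along x passes to these hulls and
   a = p yields Tp = p.  Two common points p, q coincide because <x(t), p - q> converges.  If x did
   not converge weakly to p, applying the same to the part of x in a half-space that excludes p would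
   produce a second common point. *)

theory Submission
  imports Defs
begin

section \<open>A one-sided fundamental theorem of calculus\<close>

text \<open>The increments of \<open>\<phi>\<close> are summed over a fine tagged division.
  Intervals tagged outside \<open>N\<close> are controlled by \<open>der\<close>; those tagged in
  \<open>N\<close> are controlled by \<open>dom\<close>, and their total is small by Henstock's
  lemma. Without \<open>dom\<close> the Cantor function would be a counterexample. A tag may lie
  anywhere in its interval, hence the straddling form of \<open>der\<close>.\<close>

lemma ftc_upper_bound:
  fixes \<phi> g h :: "real \<Rightarrow> real"
  assumes ab: "a \<le> b" and N: "negligible N"
    and g: "g integrable_on {a..b}" and h: "h integrable_on {a..b}"
    and dom: "\<And>u v. \<lbrakk>a \<le> u; u \<le> v; v \<le> b\<rbrakk> \<Longrightarrow> \<phi> v - \<phi> u \<le> integral {u..v} g"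
    and der: "\<And>t e. \<lbrakk>t \<in> {a..b} - N; e > 0\<rbrakk> \<Longrightarrow> \<exists>d>0. \<forall>u v. a \<le> u \<and> u \<le> t \<and> t \<le> v \<and> v \<le> b \<and>
                t - u < d \<and> v - t < d \<longrightarrow> \<phi> v - \<phi> u \<le> (h t + e) * (v - u)"
  shows "\<phi> b - \<phi> a \<le> integral {a..b} h"
proof (rule field_le_epsilon)
  fix e0 :: real
  assume e0: "e0 > 0"
  \<comment> \<open>Three errors have to fit into \<open>e0\<close>: \<open>e\<close> from the
    Riemann sum of \<open>h'\<close>, \<open>e\<close> from Henstock's lemma, and the slack
    \<open>e * (v - u)\<close>, which adds up to \<open>e * (b - a)\<close>.\<close>
  define e where "e = e0 / (2 + (b - a))"
  have e: "e > 0" using e0 ab by (simp add: e_def)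
  \<comment> \<open>With \<open>g' = 0\<close> on \<open>N\<close>, Henstock's lemma bounds the increments over all intervals tagged in \<open>N\<close>.\<close>
  define g' where "g' = (\<lambda>t. if t \<in> N then 0 else g t)"
  define h' where "h' = (\<lambda>t. if t \<in> N then 0 else h t)"
  have g': "g' integrable_on cbox a b"
    using integrable_spike[OF g[folded box_real] N, of g'] by (simp add: g'_def)
  have h': "h' integrable_on cbox a b"
    using integrable_spike[OF h[folded box_real] N, of h'] by (simp add: h'_def)
  have ig': "integral K g' = integral K g" for K
    by (rule integral_spike[OF N]) (simp add: g'_def)
  have ih': "integral K h' = integral K h" for K
    by (rule integral_spike[OF N]) (simp add: h'_def)
  obtain \<gamma>1 where \<gamma>1: "gauge \<gamma>1" "\<And>p. \<lbrakk>p tagged_partial_division_of (cbox a b); \<gamma>1 fine p\<rbrakk> \<Longrightarrow>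
             sum (\<lambda>(x,k). norm (measure lborel k *\<^sub>R g' x - integral k g')) p < e"
    by (rule Henstock_lemma[OF g' e]) blast
  obtain \<gamma>2 where \<gamma>2: "gauge \<gamma>2" "\<And>p. \<lbrakk>p tagged_division_of (cbox a b); \<gamma>2 fine p\<rbrakk> \<Longrightarrow>
             norm ((\<Sum>(x,k)\<in>p. measure lborel k *\<^sub>R h' x) - integral (cbox a b) h') < e"
    by (rule has_integralD[OF integrable_integral[OF h'] e]) blast
  have "\<forall>t. \<exists>d>0. t \<in> {a..b} - N \<longrightarrow> (\<forall>u v. a \<le> u \<and> u \<le> t \<and> t \<le> v \<and> v \<le> b \<and>
                t - u < d \<and> v - t < d \<longrightarrow> \<phi> v - \<phi> u \<le> (h t + e) * (v - u))"
    using der e by (metis zero_less_one)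
  then obtain d where d: "\<And>t. d t > 0"
     "\<And>t u v. \<lbrakk>t \<in> {a..b} - N; a \<le> u; u \<le> t; t \<le> v; v \<le> b; t - u < d t; v - t < d t\<rbrakk>
        \<Longrightarrow> \<phi> v - \<phi> u \<le> (h t + e) * (v - u)"
    by metis
  define \<gamma>3 where "\<gamma>3 = (\<lambda>t. ball t (d t))"
  have \<gamma>3: "gauge \<gamma>3" unfolding \<gamma>3_def using d(1) by (intro gauge_ball_dependent) auto
  obtain p where p: "p tagged_division_of (cbox a b)" "(\<lambda>t. \<gamma>1 t \<inter> \<gamma>2 t \<inter> \<gamma>3 t) fine p"
    using fine_division_exists[OF gauge_Int[OF gauge_Int[OF \<gamma>1(1) \<gamma>2(1)] \<gamma>3]] by metis
  have fine: "\<gamma>1 fine p" "\<gamma>2 fine p" "\<gamma>3 fine p" using p(2) by (auto simp: fine_def)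
  have "\<phi> b - \<phi> a = (\<Sum>(t,K)\<in>p. \<phi> (Sup K) - \<phi> (Inf K))"
    using additive_tagged_division_1[OF ab, of p \<phi>] p(1) by simp
  \<comment> \<open>One summand serves both kinds of tags: in \<open>N\<close> the first term
    vanishes and the last does the work; outside \<open>N\<close> the first two suffice and the last
    is nonnegative slack.\<close>
  also have "\<dots> \<le> (\<Sum>(t,K)\<in>p. measure lborel K *\<^sub>R h' t + e * measure lborel K
                      + norm (measure lborel K *\<^sub>R g' t - integral K g'))"
  proof (rule sum_mono, safe)
    fix t K assume tK: "(t, K) \<in> p"
    from tagged_division_ofD(2-4)[OF p(1) tK] obtain u v where K: "K = {u..v}" "t \<in> K" "K \<subseteq> {a..b}"
      by (metis box_real(2))
    then have uv: "u \<le> t" "t \<le> v" "a \<le> u" "v \<le> b" by auto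
    have K': "Sup K = v" "Inf K = u" "measure lborel K = v - u" using K uv by auto
    show "\<phi> (Sup K) - \<phi> (Inf K) \<le> measure lborel K *\<^sub>R h' t + e * measure lborel K
                      + norm (measure lborel K *\<^sub>R g' t - integral K g')"
    proof (cases "t \<in> N")
      case True
      have "\<phi> v - \<phi> u \<le> integral K g'" using dom[of u v] uv K(1) ig' by auto
      also have "\<dots> \<le> norm (measure lborel K *\<^sub>R g' t - integral K g')" using True by (simp add: g'_def)
      finally show ?thesis using K' True uv e by (simp add: h'_def add_increasing)
    next
      case False
      have "K \<subseteq> \<gamma>3 t" using fine(3) tK by (auto simp: fine_def)
      moreover have "u \<in> K" "v \<in> K" using K(1) uv by auto
      ultimately have "u \<in> ball t (d t)" "v \<in> ball t (d t)" unfolding \<gamma>3_def by blast+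
      then have "t - u < d t" "v - t < d t" using uv by (auto simp: dist_real_def)
      then have "\<phi> v - \<phi> u \<le> (h t + e) * (v - u)" using d(2) uv False by auto
      also have "\<dots> = measure lborel K *\<^sub>R h' t + e * measure lborel K"
        using K' False by (simp add: h'_def ring_distribs mult.commute)
      finally show ?thesis unfolding K'(1,2) by (rule add_increasing2[OF norm_ge_zero])
    qed
  qed
  also have "\<dots> = (\<Sum>(t,K)\<in>p. measure lborel K *\<^sub>R h' t) + e * (\<Sum>(t,K)\<in>p. measure lborel K)
                      + (\<Sum>(t,K)\<in>p. norm (measure lborel K *\<^sub>R g' t - integral K g'))"
    by (simp only: sum.distrib split_def sum_distrib_left)
  also have "(\<Sum>(t,K)\<in>p. measure lborel K) = b - a"
    unfolding additive_content_tagged_division[OF p(1)] using ab by simp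
  also have "(\<Sum>(t,K)\<in>p. norm (measure lborel K *\<^sub>R g' t - integral K g')) \<le> e"
    using \<gamma>1(2)[OF _ fine(1)] p(1) unfolding tagged_division_of_def by (simp add: less_imp_le)
  also have "(\<Sum>(x,k)\<in>p. measure lborel k *\<^sub>R h' x) \<le> integral {a..b} h + e"
    using \<gamma>2(2)[OF p(1) fine(2)] unfolding ih' box_real real_norm_def by linarith
  also have "integral {a..b} h + e + e * (b - a) + e = integral {a..b} h + e0"
  proof -
    have "e * (2 + (b - a)) = e0" using ab unfolding e_def by simp
    then show ?thesis by (simp add: algebra_simps)
  qed
  finally show "\<phi> b - \<phi> a \<le> integral {a..b} h + e0" by simp
qed

section \<open>Bochner integrals and absolute continuity\<close>

text \<open>Pairing the approximating simple functions with \<open>y\<close> approximates the paired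
  integrand, with the error enlarged at most by the factor \<open>norm y\<close> (Cauchy-Schwarz).
  This reduces vector-valued integrals to real ones.\<close>

lemma bochner_has_integral_inner:
  fixes f :: "'m \<Rightarrow> 'h::real_inner"
  assumes "bochner_has_integral M f I"
  shows "has_bochner_integral M (\<lambda>t. f t \<bullet> y) (I \<bullet> y)"
proof -
  from assms obtain s where f: "f \<in> borel_measurable M"
    and s: "\<And>i. Bochner_Integration.simple_bochner_integrable M (s i)"
    and lim: "(\<lambda>i. \<integral>\<^sup>+t. ennreal (norm (f t - s i t)) \<partial>M) \<longlonglongrightarrow> 0"
    and I: "(\<lambda>i. Bochner_Integration.simple_bochner_integral M (s i)) \<longlonglongrightarrow> I"
    unfolding bochner_has_integral_def by blast
  show ?thesis
  proof (rule has_bochner_integral.intros[where s = "\<lambda>i t. s i t \<bullet> y"])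
    have "continuous_on UNIV (\<lambda>z. z \<bullet> y)" by (intro continuous_intros)
    from measurable_compose[OF f borel_measurable_continuous_onI[OF this]]
    show "(\<lambda>t. f t \<bullet> y) \<in> borel_measurable M" .
    show "Bochner_Integration.simple_bochner_integrable M (\<lambda>t. s i t \<bullet> y)" for i
      using Bochner_Integration.simple_bochner_integrable_compose2[of "\<lambda>u v. u \<bullet> y", OF _ s s] by simp
    have "Bochner_Integration.simple_bochner_integral M (\<lambda>t. s i t \<bullet> y)
            = Bochner_Integration.simple_bochner_integral M (s i) \<bullet> y" for i
      by (rule Bochner_Integration.simple_bochner_integral_linear[OF
            bounded_linear.linear[OF bounded_linear_inner_left] s])
    then show "(\<lambda>i. Bochner_Integration.simple_bochner_integral M (\<lambda>t. s i t \<bullet> y)) \<longlonglongrightarrow> I \<bullet> y"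
      using tendsto_inner[OF I tendsto_const] by simp
    have bound: "(\<integral>\<^sup>+t. ennreal (norm (f t \<bullet> y - s i t \<bullet> y)) \<partial>M)
        \<le> ennreal (norm y) * (\<integral>\<^sup>+t. ennreal (norm (f t - s i t)) \<partial>M)" for i
    proof -
      \<comment> \<open>In a nonseparable space a difference of Borel functions need not be Borel.
        Here \<open>s i\<close> has finitely many values, and for each fixed value \<open>z\<close>
        the map is a continuous function of \<open>f t\<close>.\<close>
      have "(\<lambda>t. ennreal (norm (f t - s i t))) \<in> borel_measurable M"
      proof -
        from s[of i] have sf: "simple_function M (s i)" by (auto elim: simple_bochner_integrable.cases)
        have "(\<lambda>t. (\<lambda>z t. ennreal (norm (f t - z))) (s i t) t) \<in> borel_measurable M"
        proof (rule measurable_compose_countable'[where f = "\<lambda>z t. ennreal (norm (f t - z))" and g = "s i" and I = "s i ` space M"])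
          fix z :: 'h
          have "continuous_on UNIV (\<lambda>w. norm (w - z))" by (intro continuous_intros)
          from measurable_compose[OF f borel_measurable_continuous_onI[OF this]]
          show "(\<lambda>t. ennreal (norm (f t - z))) \<in> borel_measurable M" by measurable
        next
          show "s i \<in> M \<rightarrow>\<^sub>M count_space (s i ` space M)"
            using sf by (auto simp: simple_function_def measurable_count_space_eq2)
        qed (use sf in \<open>auto simp: simple_function_def intro: countable_finite\<close>)
        then show ?thesis by simp
      qed
      note [measurable] = this
      have "(\<integral>\<^sup>+t. ennreal (norm (f t \<bullet> y - s i t \<bullet> y)) \<partial>M)
          \<le> (\<integral>\<^sup>+t. ennreal (norm y) * ennreal (norm (f t - s i t)) \<partial>M)"
      proof (intro nn_integral_mono)
        fix t
        have "norm (f t \<bullet> y - s i t \<bullet> y) \<le> norm y * norm (f t - s i t)"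
          using Cauchy_Schwarz_ineq2[of "f t - s i t" y] by (simp add: inner_diff_left mult.commute)
        then show "ennreal (norm (f t \<bullet> y - s i t \<bullet> y)) \<le> ennreal (norm y) * ennreal (norm (f t - s i t))"
          by (simp add: ennreal_mult[symmetric] ennreal_leI del: real_norm_def)
      qed
      also have "\<dots> = ennreal (norm y) * (\<integral>\<^sup>+t. ennreal (norm (f t - s i t)) \<partial>M)"
        by (rule nn_integral_cmult) measurable
      finally show ?thesis .
    qed
    have lim': "(\<lambda>i. ennreal (norm y) * (\<integral>\<^sup>+t. ennreal (norm (f t - s i t)) \<partial>M)) \<longlonglongrightarrow> 0"
      using ennreal_tendsto_cmult[OF _ lim, of "ennreal (norm y)"] by simp
    show "(\<lambda>i. \<integral>\<^sup>+t. ennreal (norm (f t \<bullet> y - s i t \<bullet> y)) \<partial>M) \<longlonglongrightarrow> 0"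
      by (rule tendsto_sandwich[OF _ _ tendsto_const lim']) (use bound in \<open>simp_all del: real_norm_def\<close>)
  qed
qed

text \<open>A single simple function at L1 distance below 1 from \<open>f\<close> suffices: its norm
  is integrable, and the excess of \<open>norm (f t)\<close> over it has integral below 1.\<close>

lemma bochner_integrable_norm:
  fixes f :: "'m \<Rightarrow> 'h::real_normed_vector"
  assumes "bochner_integrable M f"
  shows "integrable M (\<lambda>t. norm (f t))"
proof -
  from assms obtain s where f: "f \<in> borel_measurable M"
    and s: "\<And>i. Bochner_Integration.simple_bochner_integrable M (s i)"
    and lim: "(\<lambda>i. \<integral>\<^sup>+t. ennreal (norm (f t - s i t)) \<partial>M) \<longlonglongrightarrow> 0"
    unfolding bochner_integrable_def bochner_has_integral_def by blast
  have nf: "(\<lambda>t. norm (f t)) \<in> borel_measurable M"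
    using f by measurable
  show ?thesis
  proof (rule integrableI_bounded[OF nf])
    have "eventually (\<lambda>i. (\<integral>\<^sup>+t. ennreal (norm (f t - s i t)) \<partial>M) < 1) sequentially"
      using order_tendstoD(2)[OF lim, of 1] by simp
    then obtain i where i: "(\<integral>\<^sup>+t. ennreal (norm (f t - s i t)) \<partial>M) < 1"
      by (auto simp: eventually_sequentially)
    have sn: "Bochner_Integration.simple_bochner_integrable M (\<lambda>t. norm (s i t))"
      using Bochner_Integration.simple_bochner_integrable_compose2[of "\<lambda>u v. norm u", OF _ s s] by simp
    then have snm: "(\<lambda>t. norm (s i t)) \<in> borel_measurable M"
      by (auto elim!: simple_bochner_integrable.cases intro: borel_measurable_simple_function)
    \<comment> \<open>The difference of norms is a measurable real function, whatever
      \<open>f - s i\<close> is. \<open>ennreal\<close> sends its negative values to 0, which does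
      not harm the splitting below.\<close>
    have "(\<integral>\<^sup>+t. ennreal (norm (f t) - norm (s i t)) \<partial>M) \<le> (\<integral>\<^sup>+t. ennreal (norm (f t - s i t)) \<partial>M)"
      by (intro nn_integral_mono ennreal_leI norm_triangle_ineq2)
    then have 1: "(\<integral>\<^sup>+t. ennreal (norm (f t) - norm (s i t)) \<partial>M) < \<infinity>"
      by (rule le_less_trans[OF _ less_trans[OF i]]) simp
    have 2: "(\<integral>\<^sup>+t. ennreal (norm (s i t)) \<partial>M) < \<infinity>"
      by (subst simple_bochner_integral_eq_nn_integral[OF sn, symmetric]) simp_all
    have "(\<integral>\<^sup>+t. ennreal (norm (f t)) \<partial>M)
        \<le> (\<integral>\<^sup>+t. ennreal (norm (f t) - norm (s i t)) + ennreal (norm (s i t)) \<partial>M)"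
    proof (intro nn_integral_mono)
      fix t
      show "ennreal (norm (f t)) \<le> ennreal (norm (f t) - norm (s i t)) + ennreal (norm (s i t))"
        by (cases "norm (s i t) \<le> norm (f t)")
           (auto simp: ennreal_plus[symmetric] ennreal_neg intro!: ennreal_leI simp del: ennreal_plus)
    qed
    also have "\<dots> = (\<integral>\<^sup>+t. ennreal (norm (f t) - norm (s i t)) \<partial>M) + (\<integral>\<^sup>+t. ennreal (norm (s i t)) \<partial>M)"
      using borel_measurable_diff[OF nf snm] snm by (intro nn_integral_add) simp_all
    also have "\<dots> < \<infinity>" using 1 2 by simp
    finally show "(\<integral>\<^sup>+t. ennreal (norm (norm (f t))) \<partial>M) < \<infinity>" by simp
  qed
qed

text \<open>The dominating \<open>g\<close> is the norm of the density \<open>f\<close>. Testing the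
  increment \<open>y\<close> against itself gives that \<open>norm y\<close> squared is the integral
  of \<open>f t \<bullet> y\<close>, hence at most \<open>norm y\<close> times the integral of
  \<open>g\<close>. In this form absolute continuity enters the flow argument.\<close>

lemma abs_continuous_upto_dominated:
  fixes x :: "real \<Rightarrow> 'h::real_inner"
  assumes "abs_continuous_upto b x"
  obtains g where "g integrable_on {0..b}"
    "\<And>s t. \<lbrakk>0 \<le> s; s \<le> t; t \<le> b\<rbrakk> \<Longrightarrow> norm (x t - x s) \<le> integral {s..t} g"
proof -
  from assms obtain c f where f: "bochner_integrable (lebesgue_on {0..b}) f"
    and x: "\<And>t. t \<in> {0..b} \<Longrightarrow> \<exists>I. bochner_has_integral (lebesgue_on {0..t}) f I \<and> x t = c + I"
    unfolding abs_continuous_upto_def by blast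
  have ng: "(\<lambda>t. norm (f t)) integrable_on {0..b}"
    using integrable_on_lebesgue_on[OF bochner_integrable_norm[OF f]] by simp
  have "norm (x t - x s) \<le> integral {s..t} (\<lambda>t. norm (f t))" if st: "0 \<le> s" "s \<le> t" "t \<le> b" for s t
  proof -
    define y where "y = x t - x s"
    have hi: "((\<lambda>t. f t \<bullet> y) has_integral ((x r - c) \<bullet> y)) {0..r}" if r: "r \<in> {0..b}" for r
    proof -
      obtain I where "bochner_has_integral (lebesgue_on {0..r}) f I" "x r = c + I" using x[OF r] by blast
      then have "has_bochner_integral (lebesgue_on {0..r}) (\<lambda>t. f t \<bullet> y) ((x r - c) \<bullet> y)"
        using bochner_has_integral_inner by fastforce
      then show ?thesis
        using has_integral_integral_lebesgue_on[of "{0..r}" "\<lambda>t. f t \<bullet> y"]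
        by (auto simp: has_bochner_integral_iff)
    qed
    have "integral {0..s} (\<lambda>t. f t \<bullet> y) + integral {s..t} (\<lambda>t. f t \<bullet> y) = integral {0..t} (\<lambda>t. f t \<bullet> y)"
      using st hi[of t] by (intro Henstock_Kurzweil_Integration.integral_combine) (auto intro: has_integral_integrable)
    then have "y \<bullet> y = integral {s..t} (\<lambda>t. f t \<bullet> y)"
      using integral_unique[OF hi[of s]] integral_unique[OF hi[of t]] st
      by (simp add: y_def inner_diff_left algebra_simps)
    also have "\<dots> \<le> integral {s..t} (\<lambda>t. norm y * norm (f t))"
    proof (rule integral_le)
      show "(\<lambda>t. f t \<bullet> y) integrable_on {s..t}"
        using integrable_on_subinterval[OF has_integral_integrable[OF hi[of t]], of s t] st by auto
      show "(\<lambda>t. norm y * norm (f t)) integrable_on {s..t}"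
        using integrable_on_subinterval[OF ng, of s t] st by (auto intro!: integrable_on_mult_right)
      show "f r \<bullet> y \<le> norm y * norm (f r)" for r
        using norm_cauchy_schwarz[of "f r" y] by (simp add: mult.commute)
    qed
    also have "\<dots> = norm y * integral {s..t} (\<lambda>t. norm (f t))" by simp
    finally have *: "norm y * norm y \<le> norm y * integral {s..t} (\<lambda>t. norm (f t))"
      by (simp add: power2_norm_eq_inner[symmetric] power2_eq_square)
    have "0 \<le> integral {s..t} (\<lambda>t. norm (f t))"
      using integrable_on_subinterval[OF ng, of s t] st by (intro integral_nonneg) auto
    then show ?thesis using * unfolding y_def[symmetric]
      by (cases "norm y = 0") (auto dest: mult_left_le_imp_le)
  qed
  with ng that show ?thesis by blast
qed

section \<open>Closed convex hulls of tails and weak convergence\<close>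

text \<open>Points of almost minimal norm in the sets \<open>K n\<close> form a Cauchy sequence: the
  infima \<open>d n\<close> increase and are bounded, and the parallelogram law turns their
  convergence into convergence of the points.\<close>

lemma nested_closed_convex_Inter_nonempty:
  fixes K :: "nat \<Rightarrow> 'h::{real_inner, complete_space} set"
  assumes closed: "\<And>n. closed (K n)" and convex: "\<And>n. convex (K n)"
    and ne: "\<And>n. K n \<noteq> {}" and bdd: "bounded (K 0)"
    and dec: "\<And>m n. m \<le> n \<Longrightarrow> K n \<subseteq> K m"
  obtains p where "\<And>n. p \<in> K n"
proof -
  define d where "d = (\<lambda>n. INF u\<in>K n. (norm u)\<^sup>2)"
  have bb: "bdd_below ((\<lambda>u. (norm u)\<^sup>2) ` K n)" for n by (rule bdd_belowI2[of _ 0]) auto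
  have d_le: "d n \<le> (norm u)\<^sup>2" if "u \<in> K n" for n u
    unfolding d_def by (rule cINF_lower[OF bb that])
  have ex: "\<exists>u\<in>K n. (norm u)\<^sup>2 < d n + inverse (Suc n)" for n
  proof (rule ccontr)
    assume "\<not> ?thesis"
    then have "d n + inverse (Suc n) \<le> d n"
      unfolding d_def by (intro cINF_greatest ne) (auto simp: not_less)
    then show False by simp
  qed
  then obtain k where k: "\<And>n. k n \<in> K n" "\<And>n. (norm (k n))\<^sup>2 < d n + inverse (Suc n)" by metis
  obtain B where B: "\<And>u. u \<in> K 0 \<Longrightarrow> norm u \<le> B" using bdd bounded_iff by metis
  have inc: "d m \<le> d n" if "m \<le> n" for m n
    unfolding d_def by (rule cINF_superset_mono[OF ne bb]) (use dec that in auto)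
  have dB: "d n \<le> B\<^sup>2" for n
  proof -
    have "d n \<le> (norm (k n))\<^sup>2" using d_le k by auto
    also have "\<dots> \<le> B\<^sup>2" using B[of "k n"] k(1)[of n] dec[of 0 n] by (intro power_mono) auto
    finally show ?thesis .
  qed
  \<comment> \<open>By monotonicity \<open>d\<close> stays above \<open>d 0\<close>, and by
    \<open>dB\<close> below \<open>B\<^sup>2\<close>; the maximum covers both sides.\<close>
  have "convergent d"
    by (rule Bseq_mono_convergent[OF BseqI'[of _ "max (B\<^sup>2) \<bar>d 0\<bar>"]])
      (use inc dB in \<open>smt (verit) inc le0 real_norm_def\<close>)+
  then have cd: "Cauchy d" by (rule convergent_Cauchy)
  have key: "(norm (k n - k m))\<^sup>2 \<le> 2 * (d m - d n) + 4 * inverse (Suc n)" if nm: "n \<le> m" for n m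
  proof -
    have km: "k m \<in> K n" using k(1)[of m] dec[OF nm] by auto
    \<comment> \<open>The midpoint stays in the larger set \<open>K n\<close>, so its squared norm
      is at least \<open>d n\<close>; the parallelogram law then bounds the distance of
      \<open>k n\<close> and \<open>k m\<close>.\<close>
    have "(1/2) *\<^sub>R k n + (1/2) *\<^sub>R k m \<in> K n"
      using convexD[OF convex k(1)[of n] km, of "1/2" "1/2"] by simp
    then have "d n \<le> (norm ((1/2) *\<^sub>R (k n + k m)))\<^sup>2" using d_le by (simp add: scaleR_add_right)
    then have 1: "4 * d n \<le> (norm (k n + k m))\<^sup>2" by (simp add: power2_eq_square)
    have 2: "(norm (k n + k m))\<^sup>2 + (norm (k n - k m))\<^sup>2 = 2 * (norm (k n))\<^sup>2 + 2 * (norm (k m))\<^sup>2"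
      by (simp add: power2_norm_eq_inner inner_add inner_diff algebra_simps)
    have "inverse (real (Suc m)) \<le> inverse (real (Suc n))" using nm by simp
    with 1 2 k(2)[of n] k(2)[of m] show ?thesis by argo
  qed
  have "Cauchy k"
  proof (rule metric_CauchyI)
    fix e :: real assume e: "e > 0"
    \<comment> \<open>With both errors below \<open>e\<^sup>2/8\<close>, \<open>key\<close> gives
      less than 2/8 + 4/8 of \<open>e\<^sup>2\<close>.\<close>
    then have e2: "e\<^sup>2/8 > 0" by simp
    obtain M1 where M1: "\<And>m n. \<lbrakk>m \<ge> M1; n \<ge> M1\<rbrakk> \<Longrightarrow> dist (d m) (d n) < e\<^sup>2/8"
      using metric_CauchyD[OF cd e2] by blast
    obtain M2 where M2: "inverse (real (Suc M2)) < e\<^sup>2/8" using reals_Archimedean[OF e2] by blast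
    have *: "dist (k n) (k m) < e" if "n \<ge> max M1 M2" "n \<le> m" for n m
    proof -
      have "inverse (real (Suc n)) \<le> inverse (real (Suc M2))" using that by simp
      moreover have "d m - d n < e\<^sup>2/8" using M1[of m n] that abs_ge_self[of "d m - d n"] by (simp add: dist_real_def)
      moreover have "e\<^sup>2 > 0" using e by simp
      ultimately have "(norm (k n - k m))\<^sup>2 < e\<^sup>2" using key[OF that(2)] M2 by argo
      then show ?thesis using e by (simp add: dist_norm power2_less_imp_less)
    qed
    show "\<exists>M. \<forall>m\<ge>M. \<forall>n\<ge>M. dist (k m) (k n) < e"
      using * by (metis dist_commute linorder_le_cases)
  qed
  then obtain p where p: "k \<longlonglongrightarrow> p" using Cauchy_convergent_iff convergent_def by blast
  have "p \<in> K n" for n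
    by (rule Lim_in_closed_set[OF closed _ _ p])
       (use k(1) dec in \<open>auto simp: eventually_sequentially intro!: exI[of _ n]\<close>)
  with that show ?thesis by blast
qed

text \<open>Half-spaces are closed and convex. This is how affine bounds along the trajectory reach
  the points of the hulls.\<close>

lemma inner_le_on_closure_convex_hull:
  fixes S :: "'h::real_inner set"
  assumes "\<And>u. u \<in> S \<Longrightarrow> y \<bullet> u \<le> c" "p \<in> closure (convex hull S)"
  shows "y \<bullet> p \<le> c"
proof -
  have "convex hull S \<subseteq> {u. y \<bullet> u \<le> c}" using assms(1) by (intro hull_minimal) (auto simp: convex_halfspace_le)
  then have "closure (convex hull S) \<subseteq> {u. y \<bullet> u \<le> c}" by (intro closure_minimal closed_halfspace_le)
  with assms(2) show ?thesis by auto
qed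

text \<open>The hulls of the tails from integer times are nested, and nonempty because
  \<open>P\<close> recurs. The predicate allows selecting part of the trajectory: it is trivial for
  existence of the limit and a half-space condition for convergence.\<close>

lemma bounded_net_convex_cluster_point:
  fixes x :: "real \<Rightarrow> 'h::{real_inner, complete_space}"
  assumes bdd: "bounded (x ` {0..})" and P: "\<exists>\<^sub>F t in at_top. P t"
  obtains p where "\<And>s. p \<in> closure (convex hull (x ` {t. s \<le> t \<and> P t}))"
proof -
  define K where "K = (\<lambda>n::nat. closure (convex hull (x ` {t. real n \<le> t \<and> P t})))"
  have mono: "closure (convex hull (x ` {t. s \<le> t \<and> P t})) \<subseteq> closure (convex hull (x ` {t. r \<le> t \<and> P t}))"
    if "r \<le> s" for r s
    by (intro closure_mono hull_mono) (use that in auto)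
  obtain p where p: "\<And>n. p \<in> K n"
  proof (rule nested_closed_convex_Inter_nonempty[of K])
    show "closed (K n)" "convex (K n)" for n by (auto simp: K_def convex_closure)
    show "K n \<noteq> {}" for n
      using P by (auto simp: K_def frequently_def eventually_at_top_linorder)
    show "bounded (K 0)"
      unfolding K_def by (intro bounded_closure bounded_convex_hull bounded_subset[OF bdd]) auto
    show "K n \<subseteq> K m" if "m \<le> n" for m n unfolding K_def using that by (intro mono) auto
  qed (use that in blast)
  have "p \<in> closure (convex hull (x ` {t. s \<le> t \<and> P t}))" for s
  proof -
    obtain n where "s \<le> real n" using real_arch_simple by blast
    then show ?thesis using mono p[of n] unfolding K_def by blast
  qed
  with that show ?thesis by blast
qed

text \<open>A form of the demiclosedness principle. Late on the trajectory
  \<open>norm (T p - u)\<close> exceeds \<open>norm (p - u)\<close> by at most \<open>e\<close>; the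
  difference of the squares is affine in \<open>u\<close>, so its bound extends to the hull and may
  be read at \<open>u = p\<close>.\<close>

lemma convex_cluster_point_in_Fix:
  fixes x :: "real \<Rightarrow> 'h::real_inner"
  assumes T: "nonexpansive T" and bdd: "bounded (x ` {0..})"
    and lim: "((\<lambda>t. T (x t) - x t) \<longlongrightarrow> 0) at_top"
    and p: "\<And>s. p \<in> closure (convex hull (x ` {t. s \<le> t}))"
  shows "p \<in> Fix T"
proof -
  obtain B where B: "\<And>t. 0 \<le> t \<Longrightarrow> norm (x t) \<le> B" using bdd by (auto simp: bounded_iff)
  define D where "D = B + norm p"
  have D: "D \<ge> 0" using B[of 0] norm_ge_zero[of "x 0"] norm_ge_zero[of p] unfolding D_def by linarith
  have "(norm (T p - p))\<^sup>2 \<le> e * (2 * D + e)" if e: "e > 0" for e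
  proof -
    from tendstoD[OF lim e] obtain s0 where "\<And>t. t \<ge> s0 \<Longrightarrow> norm (T (x t) - x t) < e"
      by (auto simp: eventually_at_top_linorder)
    then obtain s where s: "s \<ge> 0" "\<And>t. t \<ge> s \<Longrightarrow> norm (T (x t) - x t) < e"
      by (metis max.bounded_iff max.cobounded2)
    \<comment> \<open>This rewrites the bound \<open>e * (2 * D + e)\<close> on the difference of
      squares as a bound on its linear part in \<open>u\<close>, the quadratic terms having
      cancelled.\<close>
    define c where "c = e * (2 * D + e) - (norm (T p))\<^sup>2 + (norm p)\<^sup>2"
    have "(- 2 *\<^sub>R (T p - p)) \<bullet> p \<le> c"
    proof (rule inner_le_on_closure_convex_hull[OF _ p[of s]])
      fix u assume "u \<in> x ` {t. s \<le> t}"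
      then obtain t where t: "u = x t" "s \<le> t" by auto
      have "norm (T p - u) \<le> norm (T p - T u) + norm (T u - u)" 
        using norm_triangle_ineq[of "T p - T u" "T u - u"] by simp
      then have "norm (T p - u) \<le> norm (p - u) + e"
        using T s(2)[OF t(2)] t(1) by (smt (verit) nonexpansive_def)
      then have "(norm (T p - u))\<^sup>2 \<le> (norm (p - u) + e)\<^sup>2" by (intro power_mono) auto
      also have "\<dots> = (norm (p - u))\<^sup>2 + e * (2 * norm (p - u) + e)"
        by (simp add: power2_eq_square algebra_simps)
      also have "norm (p - u) \<le> D"
        using norm_triangle_ineq4[of p u] B[of t] s t by (simp add: D_def)
      then have "(norm (p - u))\<^sup>2 + e * (2 * norm (p - u) + e) \<le> (norm (p - u))\<^sup>2 + e * (2 * D + e)"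
        using e by simp
      finally show "(- 2 *\<^sub>R (T p - p)) \<bullet> u \<le> c"
        unfolding c_def by (simp add: power2_norm_eq_inner inner_diff inner_commute algebra_simps)
    qed
    then show ?thesis unfolding c_def by (simp add: power2_norm_eq_inner inner_diff inner_commute algebra_simps)
  qed
  note b = this
  have "(\<lambda>n. inverse (real (Suc n)) * (2 * D + inverse (real (Suc n)))) \<longlonglongrightarrow> 0 * (2 * D + 0)"
    by (intro tendsto_intros LIMSEQ_inverse_real_of_nat)
  then have "(norm (T p - p))\<^sup>2 \<le> 0 * (2 * D + 0)"
    by (rule LIMSEQ_le_const) (intro exI allI impI b, simp)
  then show ?thesis by (simp add: Fix_def)
qed

text \<open>A replacement for Opial's lemma that avoids weak compactness: weak cluster points are
  replaced by points common to the closed convex hulls of all tails of the trajectory.\<close>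

lemma fejer_monotone_weakly_convergent:
  fixes x :: "real \<Rightarrow> 'h::{real_inner, complete_space}"
  assumes T: "nonexpansive T" and bdd: "bounded (x ` {0..})"
    and lim: "((\<lambda>t. T (x t) - x t) \<longlongrightarrow> 0) at_top"
    and fejer: "\<And>q. q \<in> Fix T \<Longrightarrow> \<exists>l. ((\<lambda>t. (norm (x t - q))\<^sup>2) \<longlongrightarrow> l) at_top"
  shows "\<exists>p\<in>Fix T. weakly_tendsto x p at_top"
proof -
  let ?C = "\<lambda>s. closure (convex hull (x ` {t. s \<le> t}))"
  have uniq: "p = q" if pq: "\<And>s. p \<in> ?C s" "\<And>s. q \<in> ?C s" for p q
  proof -
    have F: "p \<in> Fix T" "q \<in> Fix T" using convex_cluster_point_in_Fix[OF T bdd lim] pq by blast+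
    obtain l l' where l: "((\<lambda>t. (norm (x t - p))\<^sup>2) \<longlongrightarrow> l) at_top"
      and l': "((\<lambda>t. (norm (x t - q))\<^sup>2) \<longlongrightarrow> l') at_top" using fejer F by blast
    \<comment> \<open>The limit of the right side of \<open>eq\<close> below, in which the squared
      norm of \<open>x t\<close> has cancelled.\<close>
    define L where "L = (l' - l + (norm p)\<^sup>2 - (norm q)\<^sup>2) / 2"
    have eq: "(p - q) \<bullet> x t = ((norm (x t - q))\<^sup>2 - (norm (x t - p))\<^sup>2 + (norm p)\<^sup>2 - (norm q)\<^sup>2) / 2" for t
      by (simp add: power2_norm_eq_inner inner_diff inner_commute algebra_simps)
    have L: "((\<lambda>t. (p - q) \<bullet> x t) \<longlongrightarrow> L) at_top"
      unfolding eq L_def by (intro tendsto_intros l l')  auto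
    \<comment> \<open>The functional \<open>p - q\<close> is close to \<open>L\<close> on late
      tails, hence on their hulls, so it takes the same value at \<open>p\<close> and at
      \<open>q\<close>.\<close>
    have "(p - q) \<bullet> z = L" if z: "\<And>s. z \<in> ?C s" for z
    proof -
      have "\<bar>(p - q) \<bullet> z - L\<bar> \<le> e" if e: "e > 0" for e
      proof -
        obtain s where s: "\<And>t. t \<ge> s \<Longrightarrow> \<bar>(p - q) \<bullet> x t - L\<bar> < e"
          using tendstoD[OF L e] by (auto simp: eventually_at_top_linorder dist_real_def)
        have "(p - q) \<bullet> z \<le> L + e"
          by (rule inner_le_on_closure_convex_hull[OF _ z[of s]]) (use s in \<open>force simp: abs_less_iff\<close>)
        moreover have "(- (p - q)) \<bullet> z \<le> - L + e"
        proof (rule inner_le_on_closure_convex_hull[OF _ z[of s]])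
          fix u assume "u \<in> x ` {t. s \<le> t}"
          then show "- (p - q) \<bullet> u \<le> - L + e" using s unfolding inner_minus_left by (force simp: abs_less_iff)
        qed
        ultimately show ?thesis unfolding inner_minus_left by linarith
      qed
      then show ?thesis using field_le_epsilon[of "\<bar>(p - q) \<bullet> z - L\<bar>" 0] by auto
    qed
    from this[OF pq(1)] this[OF pq(2)] have "(p - q) \<bullet> (p - q) = 0" by (simp add: inner_diff_right)
    then show ?thesis by simp
  qed
  have "\<exists>\<^sub>F t::real in at_top. True" by (simp add: frequently_def)
  then obtain p where p: "\<And>s. p \<in> ?C s"
    using bounded_net_convex_cluster_point[OF bdd, of "\<lambda>_. True"] by auto
  \<comment> \<open>If this failed, the trajectory would enter a half-space excluding
    \<open>p\<close> at arbitrarily late times, and those times alone would yield a second common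
    point. Using \<open>y\<close> and \<open>- y\<close> gives the two-sided bound.\<close>
  have upper: "\<forall>\<^sub>F t in at_top. y \<bullet> x t < y \<bullet> p + e" if e: "e > 0" for y e
  proof (rule ccontr)
    assume "\<not> ?thesis"
    then have "\<exists>\<^sub>F t in at_top. y \<bullet> p + e \<le> y \<bullet> x t" by (simp add: frequently_def not_le)
    then obtain q where q: "\<And>s. q \<in> closure (convex hull (x ` {t. s \<le> t \<and> y \<bullet> p + e \<le> y \<bullet> x t}))"
      using bounded_net_convex_cluster_point[OF bdd] by blast
    have "q \<in> ?C s" for s
      using q[of s] closure_mono[OF hull_mono[of "x ` {t. s \<le> t \<and> y \<bullet> p + e \<le> y \<bullet> x t}" "x ` {t. s \<le> t}"]]
      by blast
    then have "q = p" using uniq p by blast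
    moreover have "(- y) \<bullet> q \<le> - (y \<bullet> p + e)"
      by (rule inner_le_on_closure_convex_hull[OF _ q[of 0]]) auto
    ultimately show False using e by simp
  qed
  have "weakly_tendsto x p at_top"
    unfolding weakly_tendsto_def
  proof (intro allI tendstoI)
    fix y and e :: real assume e: "e > 0"
    show "\<forall>\<^sub>F t in at_top. dist (x t \<bullet> y) (p \<bullet> y) < e"
      using upper[OF e, of y] upper[OF e, of "- y"]
      by eventually_elim (auto simp: dist_real_def abs_less_iff inner_commute)
  qed
  moreover have "p \<in> Fix T" using convex_cluster_point_in_Fix[OF T bdd lim p] .
  ultimately show ?thesis by blast
qed

section \<open>Difference quotients and integrals on the half-line\<close>

text \<open>The first-order expansions at \<open>u\<close> and \<open>v\<close> about
  \<open>t\<close> are subtracted. Since \<open>t\<close> lies between them, the errors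
  \<open>e * (t - u)\<close> and \<open>e * (v - t)\<close> add up exactly. This supplies
  \<open>der\<close> in \<open>ftc_upper_bound\<close>.\<close>

lemma has_vector_derivative_straddle:
  fixes x :: "real \<Rightarrow> 'h::real_normed_vector"
  assumes D: "(x has_vector_derivative D) (at t within S)" and e: "e > 0"
  obtains d where "d > 0"
    "\<And>u v. \<lbrakk>u \<in> S; v \<in> S; u \<le> t; t \<le> v; t - u < d; v - t < d\<rbrakk>
       \<Longrightarrow> norm (x v - x u - (v - u) *\<^sub>R D) \<le> e * (v - u)"
proof -
  obtain d where d: "d > 0" "\<And>w. \<lbrakk>w \<in> S; norm (w - t) < d\<rbrakk> \<Longrightarrow>
      norm (x w - x t - (w - t) *\<^sub>R D) \<le> e * norm (w - t)"
    using D e unfolding has_vector_derivative_def has_derivative_within_alt by blast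
  have "norm (x v - x u - (v - u) *\<^sub>R D) \<le> e * (v - u)"
    if "u \<in> S" "v \<in> S" "u \<le> t" "t \<le> v" "t - u < d" "v - t < d" for u v
  proof -
    have "x v - x u - (v - u) *\<^sub>R D = (x v - x t - (v - t) *\<^sub>R D) - (x u - x t - (u - t) *\<^sub>R D)"
      by (simp add: algebra_simps)
    also have "norm \<dots> \<le> norm (x v - x t - (v - t) *\<^sub>R D) + norm (x u - x t - (u - t) *\<^sub>R D)"
      by (rule norm_triangle_ineq4)
    also have "\<dots> \<le> e * norm (v - t) + e * norm (u - t)"
      using that by (intro add_mono d(2)) auto
    also have "\<dots> = e * (v - u)" using that by (simp add: algebra_simps)
    finally show ?thesis .
  qed
  with d(1) that show ?thesis by blast
qed

text \<open>Monotone convergence over the segments from 0 to \<open>n\<close>. It carries the gauge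
  integral bounds of the energy estimate over to Lebesgue integrals on the half-line.\<close>

lemma nn_integral_halfline_le:
  fixes f :: "real \<Rightarrow> real"
  assumes f: "f \<in> borel_measurable (lebesgue_on {0..})" "\<And>t. 0 \<le> t \<Longrightarrow> 0 \<le> f t"
    and int: "\<And>n::nat. f integrable_on {0..real n}"
    and le: "\<And>n::nat. integral {0..real n} f \<le> C"
  shows "(\<integral>\<^sup>+t. ennreal (f t) \<partial>lebesgue_on {0..}) \<le> ennreal C"
proof -
  let ?F = "\<lambda>(n::nat) t. ennreal (indicator {0..real n} t *\<^sub>R f t)"
  have seg: "integral\<^sup>N lebesgue (?F n) \<le> ennreal C" for n
  proof -
    have ai: "f absolutely_integrable_on {0..real n}"
      using int f(2) by (intro nonnegative_absolutely_integrable_1) auto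
    have "integral\<^sup>N lebesgue (?F n) = ennreal (LINT t|lebesgue. indicator {0..real n} t *\<^sub>R f t)"
      using ai f(2) unfolding set_integrable_def
      by (intro nn_integral_eq_integral) (auto simp: indicator_def)
    also have "(LINT t|lebesgue. indicator {0..real n} t *\<^sub>R f t) = integral {0..real n} f"
      using set_lebesgue_integral_eq_integral(2)[OF ai] by (simp add: set_lebesgue_integral_def)
    finally show ?thesis using le ennreal_leI by metis
  qed
  have meas: "?F n \<in> borel_measurable lebesgue" for n
  proof -
    have "f \<in> borel_measurable (lebesgue_on {0..real n})"
      by (rule measurable_restrict_mono[OF f(1)]) auto
    then have "(\<lambda>t. indicator {0..real n} t *\<^sub>R f t) \<in> borel_measurable lebesgue"
      by (subst (asm) borel_measurable_restrict_space_iff) (auto simp: mult.commute)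
    then show ?thesis by measurable
  qed
  have "(\<integral>\<^sup>+t. ennreal (f t) \<partial>lebesgue_on {0..}) = (\<integral>\<^sup>+t. (SUP n. ?F n t) \<partial>lebesgue)"
  proof -
    have "ennreal (f t) * indicator {0..} t = (SUP n. ?F n t)" for t
    proof (cases "t \<ge> 0")
      case True
      obtain m :: nat where m: "t \<le> real m" using real_arch_simple by blast
      show ?thesis
      proof (rule antisym)
        show "ennreal (f t) * indicator {0..} t \<le> (SUP n. ?F n t)"
          by (rule SUP_upper2[of m]) (use True m in auto)
        show "(SUP n. ?F n t) \<le> ennreal (f t) * indicator {0..} t"
          by (rule SUP_least) (use True in \<open>auto simp: indicator_def\<close>)
      qed
    qed auto
    then show ?thesis by (simp add: nn_integral_restrict_space)
  qed
  also have "\<dots> = (SUP n. integral\<^sup>N lebesgue (?F n))"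
  proof (rule nn_integral_monotone_convergence_SUP)
    show "incseq ?F"
      using f(2) by (auto simp: incseq_def le_fun_def indicator_def intro!: ennreal_leI)
  qed (rule meas)
  also have "\<dots> \<le> ennreal C" by (rule SUP_least) (rule seg)
  finally show ?thesis .
qed

section \<open>Nonexpansive maps and estimates along the flow\<close>

lemma nonexpansive_continuous: "nonexpansive T \<Longrightarrow> continuous_on S T"
  by (rule continuous_onI) (metis dist_norm le_less_trans nonexpansive_def order_less_imp_le)

text \<open>Expand the square of \<open>T z - q\<close>, written as
  \<open>(z - q) + (T z - z)\<close>, and use that \<open>T\<close> does not increase the distance
  to \<open>q\<close>. The left side is the derivative of the squared distance to \<open>q\<close>
  in direction \<open>T z - z\<close>.\<close>

lemma nonexpansive_residual_inner_le:
  fixes T :: "'h::real_inner \<Rightarrow> 'h"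
  assumes "nonexpansive T" "q \<in> Fix T"
  shows "2 * ((z - q) \<bullet> (T z - z)) \<le> - (norm (T z - z))\<^sup>2"
proof -
  have "norm (T z - q) \<le> norm (z - q)" using assms by (metis (mono_tags) Fix_def mem_Collect_eq nonexpansive_def)
  then have "(norm (T z - q))\<^sup>2 \<le> (norm (z - q))\<^sup>2" by (intro power_mono) auto
  then show ?thesis by (simp add: power2_norm_eq_inner inner_diff inner_commute algebra_simps)
qed

text \<open>An explicit null set \<open>N\<close> replaces the almost-everywhere quantifier, in the
  shape that \<open>ftc_upper_bound\<close> expects.\<close>

locale nonexpansive_flow =
  fixes T :: "'h::real_inner \<Rightarrow> 'h" and lam :: "real \<Rightarrow> real" and x :: "real \<Rightarrow> 'h" and N :: "real set"
  assumes T: "nonexpansive T"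
    and lam_meas: "lam \<in> borel_measurable (lebesgue_on {0..})"
    and lam01: "\<And>t. 0 \<le> t \<Longrightarrow> 0 \<le> lam t \<and> lam t \<le> 1"
    and ac: "\<And>b. b > 0 \<Longrightarrow> abs_continuous_upto b x"
    and N: "negligible N"
    and ode: "\<And>t. \<lbrakk>0 \<le> t; t \<notin> N\<rbrakk> \<Longrightarrow> (x has_vector_derivative lam t *\<^sub>R (T (x t) - x t)) (at t within {0..})"
begin

definition residual :: "real \<Rightarrow> real" where
  "residual t = norm (T (x t) - x t)"

lemma residual_nonneg: "0 \<le> residual t"
  by (simp add: residual_def)

lemma trajectory_dominated:
  assumes "0 \<le> b"
  obtains g where "g integrable_on {0..b}"
    "\<And>s t. \<lbrakk>0 \<le> s; s \<le> t; t \<le> b\<rbrakk> \<Longrightarrow> norm (x t - x s) \<le> integral {s..t} g"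
proof -
  obtain g where g: "g integrable_on {0..b+1}"
    "\<And>s t. \<lbrakk>0 \<le> s; s \<le> t; t \<le> b+1\<rbrakk> \<Longrightarrow> norm (x t - x s) \<le> integral {s..t} g"
    using abs_continuous_upto_dominated[OF ac[of "b+1"]] assms by auto
  have "g integrable_on {0..b}" by (rule integrable_on_subinterval[OF g(1)]) auto
  with g that show ?thesis by auto
qed

text \<open>Increments of \<open>x\<close> are bounded by those of the indefinite integral of
  \<open>g\<close>, which is continuous. Near \<open>t\<close> the half-line looks like the segment
  from 0 to \<open>t+1\<close>.\<close>

lemma trajectory_continuous: "continuous_on {0..} x"
proof -
  have *: "continuous_on {0..b} x" if b: "b \<ge> 0" for b
  proof -
    obtain g where g: "g integrable_on {0..b}"
      "\<And>s t. \<lbrakk>0 \<le> s; s \<le> t; t \<le> b\<rbrakk> \<Longrightarrow> norm (x t - x s) \<le> integral {s..t} g"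
      using trajectory_dominated[OF b] by blast
    define G where "G = (\<lambda>t. integral {0..t} g)"
    have G: "continuous_on {0..b} G" unfolding G_def by (rule indefinite_integral_continuous_1[OF g(1)])
    have le: "norm (x t - x s) \<le> \<bar>G t - G s\<bar>" if "0 \<le> s" "s \<le> t" "t \<le> b" for s t
    proof -
      have "integral {0..s} g + integral {s..t} g = integral {0..t} g"
        using that integrable_on_subinterval[OF g(1), of 0 t]
        by (intro Henstock_Kurzweil_Integration.integral_combine) auto
      then show ?thesis using g(2)[OF that] unfolding G_def by linarith
    qed
    have le': "dist (x t) (x s) \<le> dist (G t) (G s)" if "s \<in> {0..b}" "t \<in> {0..b}" for s t
      using le[of s t] le[of t s] that
      by (cases "s \<le> t") (auto simp: dist_norm norm_minus_commute abs_minus_commute)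
    show ?thesis unfolding continuous_on_iff
    proof (intro ballI allI impI)
      fix s e :: real assume s: "s \<in> {0..b}" and e: "0 < e"
      then obtain d where "d > 0" "\<And>t. t \<in> {0..b} \<Longrightarrow> dist t s < d \<Longrightarrow> dist (G t) (G s) < e"
        using G unfolding continuous_on_iff by blast
      then show "\<exists>d>0. \<forall>t\<in>{0..b}. dist t s < d \<longrightarrow> dist (x t) (x s) < e"
        using le' s by (meson le_less_trans)
    qed
  qed
  have "continuous (at t within {0..}) x" if "t \<in> {0..}" for t
  proof -
    have "continuous (at t within {0..t+1}) x"
      using *[of "t+1"] that by (auto simp: continuous_on_eq_continuous_within)
    moreover have "at t within {0..} = at t within {0..t+1}"
      by (rule at_within_nhd[of t "{..<t+1}"]) auto
    ultimately show ?thesis by simp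
  qed
  then show ?thesis by (simp add: continuous_on_eq_continuous_within)
qed

lemma residual_vector_continuous: "continuous_on {0..} (\<lambda>t. T (x t) - x t)"
  by (intro continuous_intros trajectory_continuous
      continuous_on_compose2[OF nonexpansive_continuous[OF T, of UNIV] trajectory_continuous]) auto

lemma residual_continuous: "continuous_on {0..} residual"
  unfolding residual_def by (intro continuous_intros residual_vector_continuous)

lemma residual_lipschitz: "residual t - residual s \<le> 2 * norm (x t - x s)"
proof -
  have "residual t \<le> norm (T (x t) - T (x s)) + norm (T (x s) - x s) + norm (x t - x s)"
    unfolding residual_def by norm
  also have "norm (T (x t) - T (x s)) \<le> norm (x t - x s)" using T by (simp add: nonexpansive_def)
  finally show ?thesis by (simp add: residual_def)
qed

text \<open>Nothing is known about differentiability of \<open>T \<circ> x\<close>, but near a point \<open>t\<close> where the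
  equation holds, \<open>x v\<close> is up to \<open>o(v - u)\<close> a convex combination of \<open>x u\<close> and \<open>T (x u)\<close>.\<close>

lemma residual_straddle:
  assumes t: "0 \<le> t" "t \<notin> N" and e: "e > 0"
  shows "\<exists>d>0. \<forall>u v. 0 \<le> u \<and> u \<le> t \<and> t \<le> v \<and> t - u < d \<and> v - t < d \<longrightarrow>
           residual v - residual u \<le> e * (v - u)"
proof -
  let ?R = "\<lambda>t. T (x t) - x t"
  \<comment> \<open>Four errors of size \<open>e/4 * k\<close> arise, two in each of the estimates
    \<open>a\<close> and \<open>b\<close>.\<close>
  have e4: "e/4 > 0" using e by simp
  obtain d1 where d1: "d1 > 0" "\<And>u v. \<lbrakk>u \<in> {0..}; v \<in> {0..}; u \<le> t; t \<le> v; t - u < d1; v - t < d1\<rbrakk>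
       \<Longrightarrow> norm (x v - x u - (v - u) *\<^sub>R (lam t *\<^sub>R ?R t)) \<le> e/4 * (v - u)"
    by (rule has_vector_derivative_straddle[OF ode[OF t] e4]) blast
  obtain d2 where d2: "d2 > 0" "\<And>u. \<lbrakk>u \<in> {0..}; dist u t < d2\<rbrakk> \<Longrightarrow> dist (?R u) (?R t) < e/4"
    using residual_vector_continuous t(1) e4 unfolding continuous_on_iff by (metis atLeast_iff)
  have "residual v - residual u \<le> e * (v - u)"
    \<comment> \<open>The bound 1/2 on both sides keeps \<open>v - u\<close> below 1, so that
      \<open>k * l\<close> is a convex weight.\<close>
    if uv: "0 \<le> u" "u \<le> t" "t \<le> v" "t - u < Min {d1, d2, 1/2}" "v - t < Min {d1, d2, 1/2}" for u v
  proof -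
    have norm_add3: "norm (a + b + c) \<le> norm a + norm b + norm c"
      and norm_diff3: "norm (a - b - c) \<le> norm a + norm b + norm c" for a b c :: 'h
      by norm+
    define k where "k = v - u"
    define l where "l = lam t"
    define \<rho> where "\<rho> = x v - x u - k *\<^sub>R (l *\<^sub>R ?R t)"
    have k: "0 \<le> k" "k \<le> 1" using uv by (auto simp: k_def)
    have l: "0 \<le> l" "l \<le> 1" using lam01 t by (auto simp: l_def)
    have kl: "0 \<le> k * l" "k * l \<le> 1" "k * l \<le> k" using k l by (auto simp: mult_le_one mult_left_le)
    have \<rho>: "norm \<rho> \<le> e/4 * k" using d1(2)[of u v] uv by (auto simp: \<rho>_def k_def l_def)
    have Rut: "norm (?R t - ?R u) \<le> e/4" using d2(2)[of u] uv
      by (auto simp: dist_norm norm_minus_commute less_imp_le)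
    have Rlt: "k * l * norm (?R t - ?R u) \<le> k * (e/4)"
      using kl Rut k by (intro mult_mono) auto
    have a: "norm (T (x v) - T (x u)) \<le> k * l * residual u + k * (e/4) + e/4 * k"
    proof -
      have "norm (T (x v) - T (x u)) \<le> norm (x v - x u)" using T by (simp add: nonexpansive_def)
      also have "x v - x u = (k * l) *\<^sub>R ?R u + (k * l) *\<^sub>R (?R t - ?R u) + \<rho>"
        by (simp add: \<rho>_def algebra_simps)
      also have "norm \<dots> \<le> norm ((k * l) *\<^sub>R ?R u) + norm ((k * l) *\<^sub>R (?R t - ?R u)) + norm \<rho>"
        by (rule norm_add3)
      also have "\<dots> = k * l * residual u + k * l * norm (?R t - ?R u) + norm \<rho>"
        using kl by (simp add: residual_def)
      also have "\<dots> \<le> k * l * residual u + k * (e/4) + e/4 * k"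
        using Rlt \<rho> by linarith
      finally show ?thesis .
    qed
    have b: "norm (T (x u) - x v) \<le> (1 - k * l) * residual u + k * (e/4) + e/4 * k"
    proof -
      have "T (x u) - x v = (1 - k * l) *\<^sub>R ?R u - (k * l) *\<^sub>R (?R t - ?R u) - \<rho>"
        by (simp add: \<rho>_def algebra_simps)
      also have "norm \<dots> \<le> norm ((1 - k * l) *\<^sub>R ?R u) + norm ((k * l) *\<^sub>R (?R t - ?R u)) + norm \<rho>"
        by (rule norm_diff3)
      also have "\<dots> = (1 - k * l) * residual u + k * l * norm (?R t - ?R u) + norm \<rho>"
        using kl by (simp add: residual_def)
      also have "\<dots> \<le> (1 - k * l) * residual u + k * (e/4) + e/4 * k"
        using Rlt \<rho> by linarith
      finally show ?thesis .
    qed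
    \<comment> \<open>Going through \<open>T (x u)\<close>, the weights \<open>k * l\<close> from
      \<open>a\<close> and \<open>1 - k * l\<close> from \<open>b\<close> add up to one full
      \<open>residual u\<close>.\<close>
    have "residual v \<le> norm (T (x v) - T (x u)) + norm (T (x u) - x v)"
      unfolding residual_def by norm
    also have "\<dots> \<le> residual u + e * k" using a b by (simp add: algebra_simps)
    finally show ?thesis by (simp add: k_def)
  qed
  moreover have "Min {d1, d2, 1/2} > 0" using d1 d2 by simp
  ultimately show ?thesis by blast
qed

text \<open>\<open>ftc_upper_bound\<close> with \<open>h = 0\<close>:
  \<open>residual_straddle\<close> gives the derivative bound, and \<open>residual_lipschitz\<close>
  transfers the domination from \<open>x\<close> to the residual with a factor 2.\<close>

lemma residual_antimono:
  assumes "0 \<le> a" "a \<le> b"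
  shows "residual b \<le> residual a"
proof -
  obtain g where g: "g integrable_on {0..b}"
    "\<And>s t. \<lbrakk>0 \<le> s; s \<le> t; t \<le> b\<rbrakk> \<Longrightarrow> norm (x t - x s) \<le> integral {s..t} g"
    using trajectory_dominated[of b] assms by auto
  have "residual b - residual a \<le> integral {a..b} (\<lambda>_. 0)"
  proof (rule ftc_upper_bound[OF assms(2) N, where g = "\<lambda>t. 2 * g t"])
    show "(\<lambda>t. 2 * g t) integrable_on {a..b}"
      by (rule integrable_on_mult_right, rule integrable_on_subinterval[OF g(1)]) (use assms in auto)
    show "residual v - residual u \<le> integral {u..v} (\<lambda>t. 2 * g t)" if "a \<le> u" "u \<le> v" "v \<le> b" for u v
      using residual_lipschitz[of v u] g(2)[of u v] that assms by simp
    show "\<exists>d>0. \<forall>u v. a \<le> u \<and> u \<le> t \<and> t \<le> v \<and> v \<le> b \<and> t - u < d \<and> v - t < d \<longrightarrow>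
             residual v - residual u \<le> (0 + e) * (v - u)" if "t \<in> {a..b} - N" "e > 0" for t e
      using residual_straddle[of t e] that assms by (smt (verit) DiffD1 DiffD2 atLeastAtMost_iff)
  qed auto
  then show ?thesis by simp
qed

text \<open>Off \<open>N\<close> the speed is \<open>lam t * residual t\<close>, which is at most
  \<open>residual a\<close> by monotonicity; integrate the distance to \<open>x a\<close>. The
  resulting bound says something about derivatives at every time, including times in
  \<open>N\<close>.\<close>

lemma trajectory_lipschitz:
  assumes "0 \<le> a" "a \<le> b"
  shows "norm (x b - x a) \<le> residual a * (b - a)"
proof -
  obtain g where g: "g integrable_on {0..b}"
    "\<And>s t. \<lbrakk>0 \<le> s; s \<le> t; t \<le> b\<rbrakk> \<Longrightarrow> norm (x t - x s) \<le> integral {s..t} g"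
    using trajectory_dominated[of b] assms by auto
  have tri: "norm (x v - x a) - norm (x u - x a) \<le> norm (x v - x u)" for u v
    by norm
  have "norm (x b - x a) - norm (x a - x a) \<le> integral {a..b} (\<lambda>_. residual a)"
  proof (rule ftc_upper_bound[OF assms(2) N])
    show "g integrable_on {a..b}"
      by (rule integrable_on_subinterval[OF g(1)]) (use assms in auto)
    show "norm (x v - x a) - norm (x u - x a) \<le> integral {u..v} g" if "a \<le> u" "u \<le> v" "v \<le> b" for u v
      using tri[of v u] g(2)[of u v] that assms by simp
    show "\<exists>d>0. \<forall>u v. a \<le> u \<and> u \<le> t \<and> t \<le> v \<and> v \<le> b \<and> t - u < d \<and> v - t < d \<longrightarrow>
             norm (x v - x a) - norm (x u - x a) \<le> (residual a + e) * (v - u)" if t: "t \<in> {a..b} - N" "e > 0" for t e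
    proof -
      have t0: "0 \<le> t" "t \<notin> N" using t assms by auto
      obtain d where d: "d > 0" "\<And>u v. \<lbrakk>u \<in> {0..}; v \<in> {0..}; u \<le> t; t \<le> v; t - u < d; v - t < d\<rbrakk>
         \<Longrightarrow> norm (x v - x u - (v - u) *\<^sub>R (lam t *\<^sub>R (T (x t) - x t))) \<le> e * (v - u)"
        by (rule has_vector_derivative_straddle[OF ode[OF t0] t(2)]) blast
      have "norm (x v - x a) - norm (x u - x a) \<le> (residual a + e) * (v - u)"
        if uv: "a \<le> u" "u \<le> t" "t \<le> v" "v \<le> b" "t - u < d" "v - t < d" for u v
      proof -
        let ?D = "(v - u) *\<^sub>R (lam t *\<^sub>R (T (x t) - x t))"
        have "norm (x v - x u) \<le> norm (x v - x u - ?D) + norm ?D"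
          using norm_triangle_ineq[of "x v - x u - ?D" ?D] by simp
        moreover have "norm (x v - x u - ?D) \<le> e * (v - u)" using d(2)[of u v] uv assms by auto
        moreover have "norm ?D = (v - u) * (lam t * residual t)"
          using uv lam01[OF t0(1)] by (simp add: residual_def)
        moreover have "\<dots> \<le> (v - u) * (1 * residual a)"
          using uv lam01[OF t0(1)] residual_antimono[of a t] assms residual_nonneg
          by (intro mult_left_mono mult_mono) auto
        ultimately show ?thesis using tri[of v u] by (simp add: algebra_simps)
      qed
      with d(1) show ?thesis by blast
    qed
  qed auto
  then show ?thesis using assms by (simp add: mult.commute)
qed

lemma dissipation_measurable: "(\<lambda>t. lam t * (residual t)\<^sup>2) \<in> borel_measurable (lebesgue_on {0..})"
proof -
  have "residual \<in> borel_measurable (lebesgue_on {0..})"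
    by (rule continuous_imp_measurable_on_sets_lebesgue[OF residual_continuous]) auto
  with lam_meas show ?thesis by measurable
qed

lemma lam_integrable:
  assumes "0 \<le> a"
  shows "lam integrable_on {a..b}"
proof (rule measurable_bounded_by_integrable_imp_integrable_real)
  show "lam \<in> borel_measurable (lebesgue_on {a..b})"
    by (rule measurable_restrict_mono[OF lam_meas]) (use assms in auto)
  show "(\<lambda>_. 1::real) integrable_on {a..b}" by (rule integrable_const_ivl)
  show "\<bar>lam t\<bar> \<le> 1" if "t \<in> {a..b}" for t using lam01[of t] that assms by auto
qed auto

lemma dissipation_integrable:
  assumes "0 \<le> a"
  shows "(\<lambda>t. lam t * (residual t)\<^sup>2) integrable_on {a..b}"
proof (rule measurable_bounded_by_integrable_imp_integrable_real)
  show "(\<lambda>t. lam t * (residual t)\<^sup>2) \<in> borel_measurable (lebesgue_on {a..b})"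
    by (rule measurable_restrict_mono[OF dissipation_measurable]) (use assms in auto)
  show "(\<lambda>_. (residual a)\<^sup>2) integrable_on {a..b}" by (rule integrable_const_ivl)
  show "\<bar>lam t * (residual t)\<^sup>2\<bar> \<le> (residual a)\<^sup>2" if t: "t \<in> {a..b}" for t
  proof -
    have "lam t * (residual t)\<^sup>2 \<le> 1 * (residual a)\<^sup>2"
      using lam01[of t] t assms residual_antimono[of a t] residual_nonneg
      by (intro mult_mono power_mono) auto
    then show ?thesis using lam01[of t] t assms by (simp add: abs_mult)
  qed
qed auto

text \<open>Integrated form of the inequality in \<open>nonexpansive_residual_inner_le\<close>,
  multiplied by \<open>lam t\<close>, with \<open>ftc_upper_bound\<close> applied to the squared
  distance to \<open>q\<close>.\<close>

lemma energy_estimate: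
  assumes q: "q \<in> Fix T" and ab: "0 \<le> a" "a \<le> b"
  shows "(norm (x b - q))\<^sup>2 + integral {a..b} (\<lambda>t. lam t * (residual t)\<^sup>2) \<le> (norm (x a - q))\<^sup>2"
proof -
  obtain g where g: "g integrable_on {0..b}"
    "\<And>s t. \<lbrakk>0 \<le> s; s \<le> t; t \<le> b\<rbrakk> \<Longrightarrow> norm (x t - x s) \<le> integral {s..t} g"
    using trajectory_dominated[of b] ab by auto
  have "bounded (x ` {0..b})"
    by (intro compact_imp_bounded compact_continuous_image continuous_on_subset[OF trajectory_continuous]) auto
  then obtain B where B: "\<And>t. \<lbrakk>0 \<le> t; t \<le> b\<rbrakk> \<Longrightarrow> norm (x t) \<le> B"
    unfolding bounded_iff by (metis atLeastAtMost_iff imageI)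
  \<comment> \<open>A bound for the distance to \<open>q\<close> up to time \<open>b\<close>.
    Factoring the difference of squares then shows that \<open>2 * M * g\<close> dominates the
    increments of the squared distance.\<close>
  define M where "M = B + norm q"
  have M: "norm (x t - q) \<le> M" if "0 \<le> t" "t \<le> b" for t
    using B[OF that] norm_triangle_ineq4[of "x t" q] by (simp add: M_def)
  have "(norm (x b - q))\<^sup>2 - (norm (x a - q))\<^sup>2 \<le> integral {a..b} (\<lambda>t. - (lam t * (residual t)\<^sup>2))"
  proof (rule ftc_upper_bound[OF ab(2) N, where g = "\<lambda>t. 2 * M * g t"])
    show "(\<lambda>t. 2 * M * g t) integrable_on {a..b}"
      by (rule integrable_on_mult_right, rule integrable_on_subinterval[OF g(1)]) (use ab in auto)
    show "(\<lambda>t. - (lam t * (residual t)\<^sup>2)) integrable_on {a..b}"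
      using dissipation_integrable[OF ab(1)] by (rule integrable_neg)
    show "(norm (x v - q))\<^sup>2 - (norm (x u - q))\<^sup>2 \<le> integral {u..v} (\<lambda>t. 2 * M * g t)"
      if uv: "a \<le> u" "u \<le> v" "v \<le> b" for u v
    proof -
      have "(norm (x v - q))\<^sup>2 - (norm (x u - q))\<^sup>2 = (x v - x u) \<bullet> ((x v - q) + (x u - q))"
        by (simp add: power2_norm_eq_inner inner_diff inner_add inner_commute algebra_simps)
      also have "\<dots> \<le> norm (x v - x u) * norm ((x v - q) + (x u - q))" by (rule norm_cauchy_schwarz)
      also have "\<dots> \<le> integral {u..v} g * (M + M)"
        using uv ab g(2)[of u v] M[of u] M[of v]
        by (intro mult_mono order_trans[OF norm_triangle_ineq] add_mono order_trans[OF norm_ge_zero g(2)]) auto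
      finally show ?thesis by (simp add: algebra_simps)
    qed
    show "\<exists>d>0. \<forall>u v. a \<le> u \<and> u \<le> t \<and> t \<le> v \<and> v \<le> b \<and> t - u < d \<and> v - t < d \<longrightarrow>
             (norm (x v - q))\<^sup>2 - (norm (x u - q))\<^sup>2 \<le> (- (lam t * (residual t)\<^sup>2) + e) * (v - u)"
      if t: "t \<in> {a..b} - N" "e > 0" for t e
    proof -
      let ?R = "T (x t) - x t"
      have t0: "0 \<le> t" "t \<notin> N" using t ab by auto
      have "((\<lambda>s. (x s - q) \<bullet> (x s - q)) has_vector_derivative 2 * lam t * ((x t - q) \<bullet> ?R)) (at t within {0..})"
        using ode[OF t0] unfolding has_vector_derivative_def
        by (auto intro!: derivative_eq_intros simp: inner_commute algebra_simps)
      then obtain d where d: "d > 0" "\<And>u v. \<lbrakk>u \<in> {0..}; v \<in> {0..}; u \<le> t; t \<le> v; t - u < d; v - t < d\<rbrakk>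
         \<Longrightarrow> norm ((x v - q) \<bullet> (x v - q) - (x u - q) \<bullet> (x u - q)
                  - (v - u) *\<^sub>R (2 * lam t * ((x t - q) \<bullet> ?R))) \<le> e * (v - u)"
        by (rule has_vector_derivative_straddle[OF _ t(2)]) blast
      have "(norm (x v - q))\<^sup>2 - (norm (x u - q))\<^sup>2 \<le> (- (lam t * (residual t)\<^sup>2) + e) * (v - u)"
        if uv: "a \<le> u" "u \<le> t" "t \<le> v" "v \<le> b" "t - u < d" "v - t < d" for u v
      proof -
        have "2 * lam t * ((x t - q) \<bullet> ?R) \<le> - (lam t * (residual t)\<^sup>2)"
          using mult_left_mono[OF nonexpansive_residual_inner_le[OF T q, of "x t"], of "lam t"] lam01[OF t0(1)]
          by (simp add: residual_def algebra_simps)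
        from mult_right_mono[OF this, of "v - u"] uv
        have "(v - u) * (2 * lam t * ((x t - q) \<bullet> ?R)) \<le> - (lam t * (residual t)\<^sup>2) * (v - u)"
          by (simp add: mult.commute)
        moreover have "(x v - q) \<bullet> (x v - q) - (x u - q) \<bullet> (x u - q)
                  - (v - u) *\<^sub>R (2 * lam t * ((x t - q) \<bullet> ?R)) \<le> e * (v - u)"
          by (rule abs_le_D1[OF d(2)[unfolded real_norm_def]]) (use uv ab in auto)
        ultimately have "(x v - q) \<bullet> (x v - q) - (x u - q) \<bullet> (x u - q)
            \<le> - (lam t * (residual t)\<^sup>2) * (v - u) + e * (v - u)"
          unfolding real_scaleR_def by linarith
        then show ?thesis by (simp only: power2_norm_eq_inner distrib_right)
      qed
      with d(1) show ?thesis by blast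
    qed
  qed
  then show ?thesis by simp
qed

end

section \<open>Limits and integrability over the half-line\<close>

lemma antimono_bounded_below_tendsto:
  fixes f :: "real \<Rightarrow> real"
  assumes anti: "\<And>s t. \<lbrakk>0 \<le> s; s \<le> t\<rbrakk> \<Longrightarrow> f t \<le> f s" and lb: "\<And>t. c \<le> f t"
  shows "(f \<longlongrightarrow> (INF t\<in>{0..}. f t)) at_top"
proof (rule tendstoI)
  let ?l = "INF t\<in>{0..}. f t"
  fix e :: real assume e: "e > 0"
  have bb: "bdd_below (f ` {0..})" using lb by (intro bdd_belowI2) auto
  obtain t0 where t0: "0 \<le> t0" "f t0 < ?l + e"
    using cINF_less_iff[OF _ bb, of "?l + e"] e by auto
  have "dist (f t) ?l < e" if "t \<ge> t0" for t
  proof -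
    have "?l \<le> f t" using that t0 by (intro cINF_lower bb) auto
    moreover have "f t \<le> f t0" using anti that t0 by auto
    ultimately show ?thesis using t0 by (simp add: dist_real_def)
  qed
  then show "\<forall>\<^sub>F t in at_top. dist (f t) ?l < e" by (auto simp: eventually_at_top_linorder)
qed

text \<open>Makes derivatives within the half-line unique, also at its end point 0.\<close>

lemma at_within_halfline_nontrivial: "0 \<le> t \<Longrightarrow> at t within {0..} \<noteq> (bot :: real filter)"
proof
  assume "0 \<le> t" and bot: "at t within {0..} = bot"
  have "at_right t \<le> at t within {0..}" by (rule at_le) (use \<open>0 \<le> t\<close> in auto)
  with bot show False by (metis bot_unique trivial_limit_at_right_real)
qed

context nonexpansive_flow
begin

text \<open>Forward difference quotients at \<open>t\<close> are bounded by
  \<open>residual t\<close> through \<open>trajectory_lipschitz\<close>. The differential equation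
  at \<open>t\<close> is not assumed, so times in \<open>N\<close> are covered.\<close>

lemma trajectory_derivative_le_residual:
  assumes t: "0 \<le> t" and D: "(x has_vector_derivative D) (at t within {0..})"
  shows "norm D \<le> residual t"
proof (rule field_le_epsilon)
  fix e :: real assume e: "e > 0"
  obtain d where d: "d > 0" "\<And>u v. \<lbrakk>u \<in> {0..}; v \<in> {0..}; u \<le> t; t \<le> v; t - u < d; v - t < d\<rbrakk>
       \<Longrightarrow> norm (x v - x u - (v - u) *\<^sub>R D) \<le> e * (v - u)"
    by (rule has_vector_derivative_straddle[OF D e]) blast
  define k where "k = d/2"
  have k: "0 < k" "k < d" using d(1) by (auto simp: k_def)
  have "norm (x (t + k) - x t - k *\<^sub>R D) \<le> e * k" using d(2)[of t "t + k"] t k by simp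
  moreover have "norm (x (t + k) - x t) \<le> residual t * k" using trajectory_lipschitz[of t "t + k"] t k by simp
  moreover have "norm (k *\<^sub>R D) \<le> norm (x (t + k) - x t) + norm (x (t + k) - x t - k *\<^sub>R D)"
    using norm_triangle_ineq4[of "x (t + k) - x t" "x (t + k) - x t - k *\<^sub>R D"] by simp
  ultimately have "k * norm D \<le> k * (residual t + e)" using k by (simp add: algebra_simps)
  then show "norm D \<le> residual t + e" using k by simp
qed

lemma trajectory_bounded:
  assumes "q \<in> Fix T"
  shows "bounded (x ` {0..})"
  unfolding bounded_any_center[where a = q]
proof (intro exI ballI)
  fix y assume "y \<in> x ` {0..}"
  then obtain t where t: "y = x t" "0 \<le> t" by auto
  have "0 \<le> integral {0..t} (\<lambda>t. lam t * (residual t)\<^sup>2)"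
    using lam01 by (intro integral_nonneg dissipation_integrable) auto
  then have "(norm (x t - q))\<^sup>2 \<le> (norm (x 0 - q))\<^sup>2" using energy_estimate[OF assms order_refl t(2)] by linarith
  then have "norm (x t - q) \<le> norm (x 0 - q)" by (rule power2_le_imp_le) simp
  then show "dist q y \<le> norm (x 0 - q)" using t(1) by (simp add: dist_norm norm_minus_commute)
qed

text \<open>By \<open>energy_estimate\<close> the distance to a fixed point never increases (Fejer
  monotonicity), as the weak convergence result requires.\<close>

lemma distance_to_Fix_tendsto:
  assumes q: "q \<in> Fix T"
  shows "\<exists>l. ((\<lambda>t. (norm (x t - q))\<^sup>2) \<longlongrightarrow> l) at_top"
proof (rule exI, rule antimono_bounded_below_tendsto[where c = 0])
  fix s t :: real assume st: "0 \<le> s" "s \<le> t"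
  have "0 \<le> integral {s..t} (\<lambda>t. lam t * (residual t)\<^sup>2)"
    using lam01 st by (intro integral_nonneg dissipation_integrable) auto
  then show "(norm (x t - q))\<^sup>2 \<le> (norm (x s - q))\<^sup>2" using energy_estimate[OF q st] by linarith
qed simp

text \<open>Were the residual always at least \<open>e\<close>, the energy estimate would bound the
  integral of \<open>lam\<close> by \<open>(norm (x 0 - q))\<^sup>2 / e\<^sup>2\<close>, against its
  divergence. By monotonicity one time with residual below \<open>e\<close> is enough.\<close>

lemma residual_tendsto_0:
  assumes q: "q \<in> Fix T" and inf: "(\<integral>\<^sup>+t. ennreal (lam t) \<partial>(lebesgue_on {0..})) = \<infinity>"
  shows "(residual \<longlongrightarrow> 0) at_top"
proof (rule tendstoI)
  fix e :: real assume e: "e > 0"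
  have "\<exists>t0\<ge>0. residual t0 < e"
  proof (rule ccontr)
    assume "\<not> ?thesis"
    then have ge: "e \<le> residual t" if "0 \<le> t" for t using that by (auto simp: not_less)
    have "(\<integral>\<^sup>+t. ennreal (lam t) \<partial>(lebesgue_on {0..})) \<le> ennreal ((norm (x 0 - q))\<^sup>2 / e\<^sup>2)"
    proof (rule nn_integral_halfline_le[OF lam_meas])
      fix n :: nat
      have "e\<^sup>2 * integral {0..real n} lam = integral {0..real n} (\<lambda>t. e\<^sup>2 * lam t)" by simp
      also have "\<dots> \<le> integral {0..real n} (\<lambda>t. lam t * (residual t)\<^sup>2)"
      proof (rule integral_le)
        show "(\<lambda>t. e\<^sup>2 * lam t) integrable_on {0..real n}"
          by (intro integrable_on_mult_right lam_integrable) simp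
        show "e\<^sup>2 * lam t \<le> lam t * (residual t)\<^sup>2" if "t \<in> {0..real n}" for t
          using mult_left_mono[OF power_mono[OF ge, of t 2], of "lam t"] lam01[of t] that e
          by (simp add: mult.commute)
      qed (simp add: dissipation_integrable)
      also have "\<dots> \<le> (norm (x 0 - q))\<^sup>2"
        using energy_estimate[OF q order_refl, of "real n"] zero_le_power2[of "norm (x (real n) - q)"]
        by linarith
      finally show "integral {0..real n} lam \<le> (norm (x 0 - q))\<^sup>2 / e\<^sup>2"
        using e by (simp add: field_simps)
    qed (use lam01 lam_integrable in auto)
    with inf show False by (simp add: top_unique)
  qed
  then obtain t0 where t0: "0 \<le> t0" "residual t0 < e" by blast
  have "dist (residual t) 0 < e" if "t \<ge> t0" for t
    using residual_antimono[OF t0(1) that] residual_nonneg[of t] t0 by simp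
  then show "\<forall>\<^sub>F t in at_top. dist (residual t) 0 < e" by (auto simp: eventually_at_top_linorder)
qed

text \<open>Off \<open>N\<close> the squared speed is \<open>(lam t * residual t)\<^sup>2\<close>,
  which is at most the dissipation \<open>lam t * (residual t)\<^sup>2\<close> because
  \<open>lam t \<le> 1\<close>; the energy estimate bounds the integral of the latter.\<close>

lemma speed_square_integrable:
  assumes q: "q \<in> Fix T"
  shows "integrable (lebesgue_on {0..}) (\<lambda>t. (norm (vector_derivative x (at t within {0..})))\<^sup>2)"
proof -
  let ?v = "\<lambda>t. (norm (vector_derivative x (at t within {0..})))\<^sup>2"
  have diss: "integrable (lebesgue_on {0..}) (\<lambda>t. lam t * (residual t)\<^sup>2)"
  proof (rule integrableI_bounded[OF dissipation_measurable])
    have "(\<integral>\<^sup>+t. ennreal (lam t * (residual t)\<^sup>2) \<partial>(lebesgue_on {0..})) \<le> ennreal ((norm (x 0 - q))\<^sup>2)"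
    proof (rule nn_integral_halfline_le[OF dissipation_measurable])
      show "integral {0..real n} (\<lambda>t. lam t * (residual t)\<^sup>2) \<le> (norm (x 0 - q))\<^sup>2" for n
        using energy_estimate[OF q order_refl, of "real n"] zero_le_power2[of "norm (x (real n) - q)"]
        by linarith
    qed (use lam01 dissipation_integrable in auto)
    also have "(\<integral>\<^sup>+t. ennreal (lam t * (residual t)\<^sup>2) \<partial>(lebesgue_on {0..}))
        = (\<integral>\<^sup>+t. ennreal (norm (lam t * (residual t)\<^sup>2)) \<partial>(lebesgue_on {0..}))"
      using lam01 by (intro nn_integral_cong) auto
    finally show "(\<integral>\<^sup>+t. ennreal (norm (lam t * (residual t)\<^sup>2)) \<partial>(lebesgue_on {0..})) < \<infinity>"
      by (rule le_less_trans) simp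
  qed
  have "(\<lambda>t. (lam t * residual t)\<^sup>2) integrable_on {0..}"
  proof (rule measurable_bounded_by_integrable_imp_integrable_real)
    have "residual \<in> borel_measurable (lebesgue_on {0..})"
      by (rule continuous_imp_measurable_on_sets_lebesgue[OF residual_continuous]) auto
    with lam_meas show "(\<lambda>t. (lam t * residual t)\<^sup>2) \<in> borel_measurable (lebesgue_on {0..})" by measurable
    show "(\<lambda>t. lam t * (residual t)\<^sup>2) integrable_on {0..}"
      by (rule integrable_on_lebesgue_on[OF diss]) auto
    show "\<bar>(lam t * residual t)\<^sup>2\<bar> \<le> lam t * (residual t)\<^sup>2" if "t \<in> {0..}" for t
    proof -
      have "(lam t)\<^sup>2 \<le> lam t" using lam01[of t] that by (simp add: power2_eq_square mult_left_le)
      then show ?thesis by (simp add: power_mult_distrib mult_right_mono)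
    qed
  qed auto
  \<comment> \<open>Where no derivative exists \<open>vector_derivative\<close> has an unspecified
    value; such times lie in \<open>N\<close> and do not affect the integral.\<close>
  then have "?v integrable_on {0..}"
  proof (rule integrable_spike[OF _ N])
    fix t assume t: "t \<in> {0..} - N"
    then have "vector_derivative x (at t within {0..}) = lam t *\<^sub>R (T (x t) - x t)"
      by (intro vector_derivative_within at_within_halfline_nontrivial ode) auto
    then show "?v t = (lam t * residual t)\<^sup>2"
      by (simp add: residual_def power_mult_distrib)
  qed
  then have "?v absolutely_integrable_on {0..}" by (intro nonnegative_absolutely_integrable_1) auto
  then show ?thesis by (simp add: set_integrable_def integrable_restrict_space)
qed

end

theorem mainTheorem5:
  fixes T :: "'h::{real_inner, complete_space} \<Rightarrow> 'h"
    and lam :: "real \<Rightarrow> real"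
    and x0 :: 'h
    and x :: "real \<Rightarrow> 'h"
  assumes "nonexpansive T"
    and "Fix T \<noteq> {}"
    and "lam \<in> borel_measurable (lebesgue_on {0..})"
    and "\<And>t. 0 \<le> t \<Longrightarrow> lam t \<in> {0..1}"
    and "(\<integral>\<^sup>+t. ennreal (lam t) \<partial>(lebesgue_on {0..})) = \<infinity>"
    and "strong_global_solution T lam x0 x"
  shows "(bounded (x ` {0..}) \<and>
        integrable (lebesgue_on {0..}) (\<lambda>t. (norm (vector_derivative x (at t within {0..})))\<^sup>2)) \<and>
      ((\<lambda>t. T (x t) - x t) \<longlongrightarrow> 0) at_top \<and>
      ((\<lambda>t. vector_derivative x (at t within {0..})) \<longlongrightarrow> 0)
        (inf at_top (principal {t. 0 \<le> t \<and> x differentiable (at t within {0..})})) \<and>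
      (\<exists>p\<in>Fix T. weakly_tendsto x p at_top)"
proof -
  have "AE t in lebesgue. t \<in> {0..} \<longrightarrow>
      (x has_vector_derivative lam t *\<^sub>R (T (x t) - x t)) (at t within {0..})"
    using assms(6) unfolding strong_global_solution_def
    by (subst (asm) AE_restrict_space_iff) auto
  then obtain N where N: "negligible N"
    "\<And>t. \<lbrakk>0 \<le> t; t \<notin> N\<rbrakk> \<Longrightarrow> (x has_vector_derivative lam t *\<^sub>R (T (x t) - x t)) (at t within {0..})"
    unfolding eventually_ae_filter_negligible by auto
  interpret nonexpansive_flow T lam x N
    using assms N by unfold_locales (auto simp: strong_global_solution_def)
  obtain q where q: "q \<in> Fix T" using assms(2) by blast
  have res: "(residual \<longlongrightarrow> 0) at_top" by (rule residual_tendsto_0[OF q assms(5)])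
  then have lim: "((\<lambda>t. T (x t) - x t) \<longlongrightarrow> 0) at_top"
    unfolding residual_def by (rule tendsto_norm_zero_cancel)
  \<comment> \<open>Restricting the filter to times of differentiability makes
    \<open>vector_derivative\<close> a genuine derivative there, so the residual bound
    applies.\<close>
  have deriv: "((\<lambda>t. vector_derivative x (at t within {0..})) \<longlongrightarrow> 0)
        (inf at_top (principal {t. 0 \<le> t \<and> x differentiable (at t within {0..})}))"
  proof (rule Lim_null_comparison)
    show "\<forall>\<^sub>F t in inf at_top (principal {t. 0 \<le> t \<and> x differentiable (at t within {0..})}).
        norm (vector_derivative x (at t within {0..})) \<le> residual t"
      using trajectory_derivative_le_residual
      by (auto simp: eventually_inf_principal vector_derivative_works intro!: always_eventually)
    show "(residual \<longlongrightarrow> 0) (inf at_top (principal {t. 0 \<le> t \<and> x differentiable (at t within {0..})}))"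
      using res by (rule tendsto_mono[rotated]) simp
  qed
  show ?thesis
    using trajectory_bounded[OF q] speed_square_integrable[OF q] lim deriv
      fejer_monotone_weakly_convergent[OF T trajectory_bounded[OF q] lim distance_to_Fix_tendsto]
    by blast
qed

end
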